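(* Let $\mathcal{U}\times\mathcal{V}\subseteq\mathbb{R}^n\times\mathbb{R}^m$ be an open neighborhood of the origin, and let $f:\mathcal{U}\times\mathcal{V}\to\mathbb{R}^n$ be of class $C^1$ with $f(0,0)=0$. Suppose $f$ is linearly open around the origin, i.e. $\mathrm{cov} f(0,0)>0$. Then there exist a neighborhood of the origin $\mathcal{O}\subseteq\mathcal{U}\times\mathcal{V}$ and a stationary linear diffeomorphism $h:\mathcal{O}\to\mathcal{U}\times\mathcal{V}$ such that the modified system $\dot{x}=(f\circ h)(x,u)$, $t\ge 0$, is locally exponentially stabilizable by means of continuous stationary feedback laws. Further, it suffices to choose $$h(x,u)=-J^{+}x+\begin{bmatrix} 0 \\ u \end{bmatrix},\qquad J:=J_f|_{(0,0)},\quad J^{+}=J^*(JJ^* )^{-1},$$ where $0\in\mathbb{R}^n$ and $u\in\mathbb{R}^m$, and with this choice the trivial feedback law $u(x)=0$ yields the desired exponential stability of $\dot x=(f\circ h)(x,u)$.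
   Context: All norms are Euclidean; $\mathbb{B}_r(z)$ is the closed ball of radius $r$ centered at $z$; $A^*$ is the transpose of a real matrix $A$. $J_f|_{(0,0)}$ is the full $n\times(n+m)$ Jacobian of $f$ at the origin. Linear openness: a mapping $g$ into $\mathbb{R}^n$ defined near $\bar z\in\mathbb{R}^\ell$ is linearly open around $\bar z$ with modulus $\kappa>0$ if there is a neighborhood $\mathcal{W}$ of $\bar z$ such that $\mathbb{B}_{\kappa r}(g(z))\subseteq g(\mathbb{B}_r(z))$ for all $z\in\mathcal{W}$ and $r>0$ with $\mathbb{B}_r(z)\subseteq\mathcal{W}$. $\mathrm{cov}\,g(\bar z)$ denotes the supremum of all such moduli $\kappa$, with $\mathrm{cov}\,g(\bar z):=0$ if $g$ is not linearly open around $\bar z$ for any modulus. A map $h$ is stationary if $h(0,0)=(0,0)$; a stationary linear diffeomorphism $h:\mathcal{O}\to\mathcal{U}\times\mathcal{V}$ is the restriction to $\mathcal{O}$ of a linear map, which is a diffeomorphism onto its image. A system $\dot x=g(x,u)$ with $g(0,0)=0$ is locally exponentially stabilizable by means of continuous stationary feedback laws if there exist a continuous feedback $\bar u(x)$ defined near $0\in\mathbb{R}^n$ with $\bar u(0)=0$ and constants $\alpha,M,\delta>0$ such that for every $x_0$ with $\|x_0\|<\delta$ there is a unique solution $\phi(t,x_0)$ of $\dot x=g(x,\bar u(x))$ with $\phi(0,x_0)=x_0$, and $\|\phi(t,x_0)\|\le M\|x_0\|e^{-\alpha t}$ for all $t\ge 0$.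
   Formalization: The explicit h is claimed to be a diffeomorphism only when the first n columns of J form an invertible matrix (exactly when h is injective); for f(x,u)=u it gives h(x,u)=(0,u-x), not injective. All else, including existence of some diffeomorphism h, is unconditional. *)

theory Defs
  imports "HOL-Analysis.Analysis"
begin

text \<open>
  Maps defined on an open set \<open>D\<close> are total functions together with the explicit domain \<open>D\<close>;
  nothing below depends on their values outside \<open>D\<close>. The state-control space is the product type
  \<open>(real^'n) \<times> (real^'m)\<close>, whose norm is the Euclidean one.
\<close>

definition C1_on :: "'a::real_normed_vector set \<Rightarrow> ('a \<Rightarrow> 'b::real_normed_vector) \<Rightarrow> bool" where
  "C1_on S f \<longleftrightarrow>
     (\<exists>f'. (\<forall>z\<in>S. (f has_derivative blinfun_apply (f' z)) (at z)) \<and> continuous_on S f')"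

definition linearly_open_around ::
  "'a::metric_space set \<Rightarrow> ('a \<Rightarrow> 'b::metric_space) \<Rightarrow> 'a \<Rightarrow> real \<Rightarrow> bool" where
  "linearly_open_around D g z0 \<kappa> \<longleftrightarrow>
     \<kappa> > 0 \<and>
     (\<exists>W. open W \<and> z0 \<in> W \<and> W \<subseteq> D \<and>
        (\<forall>z\<in>W. \<forall>r>0. cball z r \<subseteq> W \<longrightarrow> cball (g z) (\<kappa> * r) \<subseteq> g ` cball z r))"

text \<open>The supremum is taken in the extended reals, so that it never degenerates when the set of
  moduli is unbounded.\<close>

definition cov :: "'a::metric_space set \<Rightarrow> ('a \<Rightarrow> 'b::metric_space) \<Rightarrow> 'a \<Rightarrow> ereal" where
  "cov D g z0 =
     (if \<exists>\<kappa>. linearly_open_around D g z0 \<kappa>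
      then SUP \<kappa> \<in> {\<kappa>. linearly_open_around D g z0 \<kappa>}. ereal \<kappa>
      else 0)"

definition diffeo_onto_image :: "'a::real_normed_vector set \<Rightarrow> ('a \<Rightarrow> 'b::real_normed_vector) \<Rightarrow> bool" where
  "diffeo_onto_image S h \<longleftrightarrow>
     open S \<and> open (h ` S) \<and> inj_on h S \<and> C1_on S h \<and> C1_on (h ` S) (inv_into S h)"

definition stationary_linear_diffeo ::
  "'a::real_normed_vector set \<Rightarrow> ('a \<Rightarrow> 'b::real_normed_vector) \<Rightarrow> bool" where
  "stationary_linear_diffeo S h \<longleftrightarrow>
     h 0 = 0 \<and> (\<exists>L. linear L \<and> (\<forall>z\<in>S. h z = L z)) \<and> diffeo_onto_image S h"

text \<open>\<open>solves_ode F X I x\<close>: the curve \<open>x\<close> stays in the domain \<open>X\<close> of the vector field \<open>F\<close> and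
  satisfies the differential equation on the time interval \<open>I\<close> (one-sided at its endpoints).\<close>

definition solves_ode ::
  "('a::real_normed_vector \<Rightarrow> 'a) \<Rightarrow> 'a set \<Rightarrow> real set \<Rightarrow> (real \<Rightarrow> 'a) \<Rightarrow> bool" where
  "solves_ode F X I x \<longleftrightarrow>
     (\<forall>t\<in>I. x t \<in> X \<and> (x has_vector_derivative F (x t)) (at t within I))"

text \<open>Uniqueness of the solution is meant in the usual sense for initial value problems: any other
  solution with the same initial value, on any interval \<open>{0..<T}\<close>, coincides there with \<open>\<phi>\<close>.
  In particular \<open>\<phi>\<close> is the only solution on \<open>{0..}\<close>.\<close>

definition exp_stabilizing_feedback ::
  "('a::real_normed_vector \<times> 'b::real_normed_vector) set \<Rightarrow> ('a \<times> 'b \<Rightarrow> 'a) \<Rightarrow> 'a set \<Rightarrow> ('a \<Rightarrow> 'b) \<Rightarrow> bool"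
  where
  "exp_stabilizing_feedback D g X u \<longleftrightarrow>
     open X \<and> 0 \<in> X \<and> (\<forall>x\<in>X. (x, u x) \<in> D) \<and> continuous_on X u \<and> u 0 = 0 \<and>
     (\<exists>\<alpha>>0. \<exists>M>0. \<exists>\<delta>>0. \<forall>x0. norm x0 < \<delta> \<longrightarrow>
        (\<exists>\<phi>. solves_ode (\<lambda>x. g (x, u x)) X {0..} \<phi> \<and> \<phi> 0 = x0 \<and>
             (\<forall>T>0. \<forall>\<psi>. solves_ode (\<lambda>x. g (x, u x)) X {0..<T} \<psi> \<and> \<psi> 0 = x0 \<longrightarrow>
                (\<forall>t\<in>{0..<T}. \<psi> t = \<phi> t)) \<and>
             (\<forall>t\<ge>0. norm (\<phi> t) \<le> M * norm x0 * exp (- \<alpha> * t))))"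

definition locally_exp_stabilizable ::
  "('a::real_normed_vector \<times> 'b::real_normed_vector) set \<Rightarrow> ('a \<times> 'b \<Rightarrow> 'a) \<Rightarrow> bool" where
  "locally_exp_stabilizable D g \<longleftrightarrow>
     g (0, 0) = 0 \<and> (\<exists>X u. exp_stabilizing_feedback D g X u)"

text \<open>The identification of a pair with the stacked column vector indexed by the sum type, so that
  the Jacobian is an \<open>n \<times> (n+m)\<close> matrix.\<close>

definition stack :: "(real^'n) \<times> (real^'m) \<Rightarrow> real^('n::finite + 'm::finite)" where
  "stack z = (\<chi> k. case k of Inl i \<Rightarrow> fst z $ i | Inr j \<Rightarrow> snd z $ j)"

definition unstack :: "real^('n::finite + 'm::finite) \<Rightarrow> (real^'n) \<times> (real^'m)" where
  "unstack v = ((\<chi> i. v $ Inl i), (\<chi> j. v $ Inr j))"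

definition full_jacobian ::
  "((real^'n::finite) \<times> (real^'m::finite) \<Rightarrow> real^'k::finite) \<Rightarrow> (real^'n) \<times> (real^'m) \<Rightarrow> real^('n + 'm)^'k" where
  "full_jacobian f z = jacobian (f \<circ> unstack) (at (stack z))"

definition right_pinv :: "real^'k::finite^'n::finite \<Rightarrow> real^'n^'k" where
  "right_pinv J = transpose J ** matrix_inv (J ** transpose J)"

text \<open>\<open>pinv_change J\<close> is linear for every \<open>J\<close>, but it is injective only if the block of the first
  \<open>n\<close> columns of \<open>J\<close> is invertible: for \<open>n = m = 1\<close> and \<open>J = [0, 1]\<close> it maps \<open>(x, u)\<close> to
  \<open>(0, u - x)\<close>.\<close>

definition pinv_change ::
  "real^('n::finite + 'm::finite)^'n \<Rightarrow> (real^'n) \<times> (real^'m) \<Rightarrow> (real^'n) \<times> (real^'m)" where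
  "pinv_change J = (\<lambda>(x, u). unstack (- (right_pinv J *v x) + stack (0, u)))"

definition state_block :: "real^('n::finite + 'm::finite)^'n \<Rightarrow> real^'n^'n" where
  "state_block J = (\<chi> i j. J $ i $ Inl j)"

end

theory Submission
  imports Defs
begin

text \<open>
  If the range of \<open>f'(0)\<close> lay in a hyperplane with normal \<open>p\<close>, then \<open>p \<bullet> f\<close> would be \<open>o(r)\<close> on
  balls of radius \<open>r\<close>, contradicting linear openness; so \<open>f'(0)\<close> is onto and every linear right inverse
  \<open>R\<close> gives \<open>f'(0) (- R x) = - x\<close>. The closed-loop field is then \<open>- x + G x\<close> with \<open>G\<close> a
  \<open>1/2\<close>-Lipschitz map near \<open>0\<close>. After extending \<open>G\<close> by the projection onto a ball, solutions on all
  of \<open>[0, \<infinity>)\<close> are fixed points of the contraction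
  \<open>x \<mapsto> exp (-t) (x\<^sub>0 + \<integral>\<^bsub>[0,t]\<^esub> exp s G (x s) ds)\<close> on bounded continuous functions, and dissipativity of
  the field yields both uniqueness and the decay rate \<open>1/2\<close>. Since \<open>pinv_change\<close> may fail to be
  injective, the diffeomorphism of the first claim uses an isomorphism of the control space with the
  kernel of \<open>f'(0)\<close> instead.
\<close>

section \<open>Decay and global existence for dissipative equations\<close>

text \<open>Gronwall argument: \<open>exp (2 * a * s)\<close> is the integrating factor for the
  squared norm, so the weighted squared norm \<open>d\<close> is nonincreasing. Applied to a
  solution it gives decay; applied to the difference of two solutions it gives uniqueness.\<close>

lemma dissipative_imp_exp_decay:
  fixes w :: "real \<Rightarrow> 'a::real_inner"
  assumes t: "0 \<le> t"
    and w': "\<And>s. 0 \<le> s \<Longrightarrow> s \<le> t \<Longrightarrow> (w has_vector_derivative w' s) (at s within {0..t})"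
    and diss: "\<And>s. 0 \<le> s \<Longrightarrow> s \<le> t \<Longrightarrow> w s \<bullet> w' s \<le> - a * (w s \<bullet> w s)"
  shows "norm (w t) \<le> norm (w 0) * exp (- a * t)"
proof -
  define d where "d s = exp (2 * a * s) * (w s \<bullet> w s)" for s
  have d': "(d has_real_derivative 2 * exp (2 * a * s) * (w s \<bullet> w' s + a * (w s \<bullet> w s))) (at s within {0..t})"
    if "0 \<le> s" "s \<le> t" for s
  proof -
    have "((\<lambda>s. w s \<bullet> w s) has_real_derivative (2 * (w s \<bullet> w' s))) (at s within {0..t})"
      unfolding has_field_derivative_def
      by (rule has_derivative_eq_rhs[OF has_derivative_inner])
        (use w'[OF that] in \<open>auto simp: has_vector_derivative_def inner_commute fun_eq_iff\<close>)
    then show ?thesis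
      unfolding d_def by (auto intro!: derivative_eq_intros simp: algebra_simps)
  qed
  \<comment> \<open>Monotonicity needs the sign of the derivative only at interior times; at the
    endpoints the one-sided derivatives supply continuity.\<close>
  have "d t \<le> d 0"
  proof (rule DERIV_nonpos_imp_decreasing_open[OF t])
    show "continuous_on {0..t} d"
      by (rule DERIV_continuous_on) (use d' in auto)
    fix s assume s: "0 < s" "s < t"
    then have "(d has_real_derivative 2 * exp (2 * a * s) * (w s \<bullet> w' s + a * (w s \<bullet> w s))) (at s)"
      using d'[of s] by (simp add: at_within_Icc_at)
    moreover have "2 * exp (2 * a * s) * (w s \<bullet> w' s + a * (w s \<bullet> w s)) \<le> 0"
      using diss[of s] s by (intro mult_nonneg_nonpos) auto
    ultimately show "\<exists>y. DERIV d s :> y \<and> y \<le> 0" by blast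
  qed
  then have "exp (2 * a * t) * (norm (w t))\<^sup>2 \<le> (norm (w 0))\<^sup>2"
    by (simp add: d_def power2_norm_eq_inner)
  then have "(exp (a * t) * norm (w t))\<^sup>2 \<le> (norm (w 0))\<^sup>2"
    by (simp add: power_mult_distrib power2_eq_square[of "exp _"] mult.assoc flip: exp_add)
  then have "exp (a * t) * norm (w t) \<le> norm (w 0)"
    by (rule power2_le_imp_le) simp
  then show ?thesis
    by (simp add: exp_minus field_simps)
qed

text \<open>Variation of constants relative to the linear part \<open>- x\<close>. The damping
  factor \<open>exp (- t)\<close> keeps the contraction constant equal to \<open>c\<close> on the
  whole half-line, so one fixed point yields a global solution without any continuation
  argument.\<close>

lemma global_solution_exists:
  fixes G :: "'a::banach \<Rightarrow> 'a"
  assumes lip: "\<And>x y. norm (G x - G y) \<le> c * norm (x - y)" and c: "0 \<le> c" "c < 1"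
  obtains \<phi> where "\<phi> 0 = x0"
    "\<And>t. 0 \<le> t \<Longrightarrow> (\<phi> has_vector_derivative G (\<phi> t) - \<phi> t) (at t within {0..})"
proof -
  have Gcont: "continuous_on UNIV G"
    by (rule lipschitz_on_continuous_on[of c]) (use lip c in \<open>auto simp: lipschitz_on_def dist_norm\<close>)
  define E where "E x s = exp s *\<^sub>R G (x s)" for x and s :: real
  define I where "I x t = integral {0..t} (E x)" for x t
  define \<Phi> where "\<Phi> x t = exp (- t) *\<^sub>R (x0 + I x t)" for x t
  have Econt: "continuous_on S (E (apply_bcontfun x))" for x S
    unfolding E_def
    by (intro continuous_intros continuous_on_compose2[OF Gcont]) auto
  have I': "(I (apply_bcontfun x) has_vector_derivative E x t) (at t within {0..})" if "0 \<le> t" for x t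
  proof -
    \<comment> \<open>The interval ends at \<open>t+1\<close> rather than \<open>t\<close>, so that
      it coincides with \<open>{0..}\<close> near \<open>t\<close>.\<close>
    have "(I x has_vector_derivative E x t) (at t within {0..t+1})"
      unfolding I_def using that by (intro integral_has_vector_derivative Econt) auto
    moreover have "at t within {0..t+1} = at t within {0..}"
      using that by (intro at_within_nhd[of _ "{..<t+1}"]) auto
    ultimately show ?thesis by simp
  qed
  have \<Phi>': "(\<Phi> (apply_bcontfun x) has_vector_derivative G (x t) - \<Phi> x t) (at t within {0..})"
    if "0 \<le> t" for x t
    unfolding \<Phi>_def
    by (rule derivative_eq_intros I'[OF that] refl)+
      (simp add: E_def algebra_simps exp_minus)
  have int: "(E (apply_bcontfun x)) integrable_on {0..t}" for x t
    by (intro integrable_continuous_real Econt)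
  have exp_int: "((\<lambda>s. exp s * b) has_integral (exp t - 1) * b) {0..t}" if "0 \<le> t" for t b :: real
  proof -
    have "((\<lambda>s. exp s * b) has_vector_derivative exp s * b) (at s within {0..t})" for s
      unfolding has_real_derivative_iff_has_vector_derivative[symmetric]
      by (auto intro!: derivative_eq_intros)
    from fundamental_theorem_of_calculus[OF that this] show ?thesis
      by (simp add: algebra_simps)
  qed
  \<comment> \<open>The kernel \<open>exp (s - t)\<close> has mass \<open>1 - exp (- t)\<close> on
    \<open>{0..t}\<close>, which is at most 1; this gives both the boundedness and the contraction
    estimate.\<close>
  have le: "exp (- t) * ((exp t - 1) * b) \<le> b" if "0 \<le> t" "0 \<le> b" for t b :: real
    using that by (simp add: algebra_simps exp_minus)
  \<comment> \<open>Elements of the bounded continuous function space live on all of the reals;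
    \<open>max 0 t\<close> extends the curve to negative times by its value at 0.\<close>
  define P where "P x = Bcontfun (\<lambda>t. \<Phi> (apply_bcontfun x) (max 0 t))" for x
  have P: "apply_bcontfun (P x) = (\<lambda>t. \<Phi> x (max 0 t))" for x
  proof -
    have "bounded (range (apply_bcontfun x))" by simp
    then obtain B where B: "\<And>t. norm (x t) \<le> B"
      by (auto simp: bounded_iff)
    have "0 \<le> B" using B[of 0] norm_ge_zero order_trans by blast
    define C where "C = norm (G 0) + c * B"
    have C: "norm (G (x s)) \<le> C" for s
    proof -
      have "norm (G (x s)) \<le> norm (G 0) + norm (G (x s) - G 0)"
        by (metis add.commute diff_add_cancel norm_triangle_ineq)
      also have "\<dots> \<le> norm (G 0) + c * B"
        using lip[of "x s" 0] mult_left_mono[OF B[of s] c(1)] by simp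
      finally show ?thesis by (simp add: C_def)
    qed
    have "0 \<le> C" using C norm_ge_zero order_trans by blast
    have "norm (\<Phi> x t) \<le> norm x0 + C" if "0 \<le> t" for t
    proof -
      have I: "norm (I x t) \<le> (exp t - 1) * C"
        unfolding I_def integral_unique[OF exp_int[OF that], symmetric]
        by (rule integral_norm_bound_integral[OF int has_integral_integrable[OF exp_int[OF that]]])
          (use C in \<open>simp add: E_def\<close>)
      have "norm (\<Phi> x t) \<le> exp (- t) * (norm x0 + norm (I x t))"
        by (simp add: \<Phi>_def norm_triangle_ineq)
      also have "\<dots> \<le> exp (- t) * norm x0 + exp (- t) * ((exp t - 1) * C)"
        using I by (simp add: distrib_left)
      also have "\<dots> \<le> norm x0 + C"
        using le[OF that \<open>0 \<le> C\<close>] that by (intro add_mono) (auto simp: mult_left_le_one_le)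
      finally show ?thesis .
    qed
    moreover have "continuous_on {0..} (\<Phi> x)"
      unfolding continuous_on_eq_continuous_within
      using \<Phi>' has_vector_derivative_continuous by (metis atLeast_iff)
    then have "continuous_on UNIV (\<lambda>t. \<Phi> x (max 0 t))"
      by (rule continuous_on_compose2) (auto intro!: continuous_intros)
    ultimately show ?thesis
      unfolding P_def by (intro Bcontfun_inverse bcontfun_normI[of _ "norm x0 + C"]) auto
  qed
  have "dist (P x) (P y) \<le> c * dist x y" for x y
  proof (rule dist_bound)
    fix t0 :: real
    define t where "t = max 0 t0"
    have t: "0 \<le> t" by (simp add: t_def)
    define b where "b = c * dist x y"
    have "0 \<le> b" using c by (simp add: b_def)
    have "norm (G (x s) - G (y s)) \<le> b" for s
      using lip[of "x s" "y s"] mult_left_mono[OF dist_bounded[of x s y] c(1)]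
      by (simp add: b_def dist_norm)
    then have E: "norm (E x s - E y s) \<le> exp s * b" for s
      by (simp add: E_def flip: scaleR_diff_right)
    have "I x t - I y t = integral {0..t} (\<lambda>s. E x s - E y s)"
      unfolding I_def by (simp add: integral_diff int)
    also have "norm \<dots> \<le> (exp t - 1) * b"
      unfolding integral_unique[OF exp_int[OF t], symmetric]
      by (rule integral_norm_bound_integral[OF _ has_integral_integrable[OF exp_int[OF t]] E])
        (intro integrable_diff int)
    finally have "norm (I x t - I y t) \<le> (exp t - 1) * b" .
    then have "norm (\<Phi> x t - \<Phi> y t) \<le> exp (- t) * ((exp t - 1) * b)"
      by (simp add: \<Phi>_def flip: scaleR_diff_right)
    with le[OF t \<open>0 \<le> b\<close>] show "dist (P x t0) (P y t0) \<le> c * dist x y"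
      unfolding P dist_norm b_def t_def by linarith
  qed
  then obtain x where x: "P x = x"
    using banach_fix_type[OF c, of P] by auto
  have fix_eq: "x t = \<Phi> x t" if "0 \<le> t" for t
    using arg_cong[OF x, of "\<lambda>x. apply_bcontfun x t"] that by (simp add: P)
  \<comment> \<open>The derivative of \<open>\<Phi> x\<close> is already known, so
    \<open>\<Phi> x\<close> serves as the solution; the fixed-point equation only replaces
    \<open>x t\<close> inside \<open>G\<close>.\<close>
  show thesis
  proof
    show "\<Phi> x 0 = x0" by (simp add: \<Phi>_def I_def)
    show "(\<Phi> x has_vector_derivative G (\<Phi> x t) - \<Phi> x t) (at t within {0..})" if "0 \<le> t" for t
      using \<Phi>'[OF that, of x] fix_eq[OF that] by simp
  qed
qed

section \<open>Exponential stability under the zero feedback\<close>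

text \<open>The closed-loop field is \<open>- x\<close> plus a remainder with Lipschitz constant
  1/2. Since the projection \<open>p\<close> onto the closed ball is nonexpansive, composing with it
  extends the remainder to the whole space with the same constant. Decay then confines the global
  solution to the ball, where the extended field is the original one.\<close>

lemma exp_stabilizing_feedback_zero:
  fixes g :: "'a::euclidean_space \<times> 'b::real_normed_vector \<Rightarrow> 'a"
  assumes \<rho>: "0 < \<rho>" and g0: "g (0, 0) = 0"
    and lip: "\<And>x y. x \<in> cball 0 \<rho> \<Longrightarrow> y \<in> cball 0 \<rho> \<Longrightarrow>
      norm ((g (x, 0) + x) - (g (y, 0) + y)) \<le> 1/2 * norm (x - y)"
    and D: "\<And>x. x \<in> ball 0 \<rho> \<Longrightarrow> (x, 0) \<in> D"
  shows "exp_stabilizing_feedback D g (ball 0 \<rho>) (\<lambda>x. 0)"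
proof -
  define p where "p = closest_point (cball (0::'a) \<rho>)"
  define G where "G x = g (p x, 0) + p x" for x
  have p_in: "p x \<in> cball 0 \<rho>" for x
    unfolding p_def using \<rho> by (intro closest_point_in_set) auto
  have p_id: "p x = x" if "x \<in> cball 0 \<rho>" for x
    unfolding p_def using that by (rule closest_point_self)
  have G_lip: "norm (G x - G y) \<le> 1/2 * norm (x - y)" for x y
  proof -
    have "norm (p x - p y) \<le> norm (x - y)"
      using closest_point_lipschitz[of "cball (0::'a) \<rho>" x y] \<rho> by (simp add: p_def dist_norm)
    then show ?thesis
      using lip[OF p_in p_in, of x y] by (simp add: G_def)
  qed
  have G0: "G 0 = 0" using p_id[of 0] \<rho> g0 by (simp add: G_def)
  have G_eq: "G x - x = g (x, 0)" if "x \<in> ball 0 \<rho>" for x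
    using p_id[of x] that by (simp add: G_def)
  \<comment> \<open>The linear part contributes -1 and, by Cauchy-Schwarz, the remainder at most
    1/2. The case \<open>y = 0\<close> gives decay, a general pair gives uniqueness.\<close>
  have diss: "(x - y) \<bullet> ((G x - x) - (G y - y)) \<le> - (1/2) * ((x - y) \<bullet> (x - y))" for x y
  proof -
    have "(x - y) \<bullet> (G x - G y) \<le> norm (x - y) * norm (G x - G y)"
      by (rule norm_cauchy_schwarz)
    also have "\<dots> \<le> norm (x - y) * (1/2 * norm (x - y))"
      by (intro mult_left_mono G_lip) simp
    finally have "(x - y) \<bullet> (G x - G y) \<le> 1/2 * ((x - y) \<bullet> (x - y))"
      by (simp add: dot_square_norm power2_eq_square)
    moreover have "(G x - x) - (G y - y) = (G x - G y) - (x - y)" by simp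
    ultimately show ?thesis by (simp only: inner_diff_right[of "x - y" "G x - G y"])
  qed
  have "\<exists>\<phi>. solves_ode (\<lambda>x. g (x, 0)) (ball 0 \<rho>) {0..} \<phi> \<and> \<phi> 0 = x0 \<and>
          (\<forall>T>0. \<forall>\<psi>. solves_ode (\<lambda>x. g (x, 0)) (ball 0 \<rho>) {0..<T} \<psi> \<and> \<psi> 0 = x0 \<longrightarrow>
             (\<forall>t\<in>{0..<T}. \<psi> t = \<phi> t)) \<and>
          (\<forall>t\<ge>0. norm (\<phi> t) \<le> 1 * norm x0 * exp (- (1/2) * t))"
    if x0: "norm x0 < \<rho>" for x0
  proof -
    obtain \<phi> where \<phi>0: "\<phi> 0 = x0"
      and \<phi>': "\<And>t. 0 \<le> t \<Longrightarrow> (\<phi> has_vector_derivative G (\<phi> t) - \<phi> t) (at t within {0..})"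
      by (rule global_solution_exists[OF G_lip, of x0]) auto
    have decay: "norm (\<phi> t) \<le> norm x0 * exp (- (1/2) * t)" if t: "0 \<le> t" for t
      unfolding \<phi>0[symmetric] using t
    proof (rule dissipative_imp_exp_decay)
      fix s assume s: "0 \<le> s" "s \<le> t"
      show "(\<phi> has_vector_derivative G (\<phi> s) - \<phi> s) (at s within {0..t})"
        using \<phi>'[OF s(1)] by (rule has_vector_derivative_within_subset) auto
      show "\<phi> s \<bullet> (G (\<phi> s) - \<phi> s) \<le> - (1/2) * (\<phi> s \<bullet> \<phi> s)"
        using diss[of "\<phi> s" 0] G0 by simp
    qed
    have \<phi>_in: "\<phi> t \<in> ball 0 \<rho>" if "0 \<le> t" for t
    proof -
      have "norm x0 * exp (- (1/2) * t) \<le> norm x0"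
        using that by (simp add: mult_left_le)
      then show ?thesis using decay[OF that] x0 by simp
    qed
    \<comment> \<open>A competing solution stays in the ball by definition, hence also solves the
      extended equation; its difference from \<open>\<phi>\<close> starts at zero and so remains
      zero.\<close>
    have unique: "\<psi> t = \<phi> t"
      if \<psi>: "solves_ode (\<lambda>x. g (x, 0)) (ball 0 \<rho>) {0..<T} \<psi>" "\<psi> 0 = x0" and t: "t \<in> {0..<T}" for T \<psi> t
    proof -
      have "norm (\<psi> t - \<phi> t) \<le> norm (\<psi> 0 - \<phi> 0) * exp (- (1/2) * t)"
      proof (rule dissipative_imp_exp_decay)
        show "0 \<le> t" using t by simp
        fix s assume s: "0 \<le> s" "s \<le> t"
        have "\<psi> s \<in> ball 0 \<rho>" and "(\<psi> has_vector_derivative g (\<psi> s, 0)) (at s within {0..<T})"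
          using \<psi>(1) s t by (auto simp: solves_ode_def)
        then have "(\<psi> has_vector_derivative G (\<psi> s) - \<psi> s) (at s within {0..<T})"
          by (simp only: G_eq)
        then have "(\<psi> has_vector_derivative G (\<psi> s) - \<psi> s) (at s within {0..t})"
          by (rule has_vector_derivative_within_subset) (use t in auto)
        moreover have "(\<phi> has_vector_derivative G (\<phi> s) - \<phi> s) (at s within {0..t})"
          using \<phi>'[OF s(1)] by (rule has_vector_derivative_within_subset) auto
        ultimately show "((\<lambda>s. \<psi> s - \<phi> s) has_vector_derivative
            (G (\<psi> s) - \<psi> s) - (G (\<phi> s) - \<phi> s)) (at s within {0..t})"
          by (rule has_vector_derivative_diff)
        show "(\<psi> s - \<phi> s) \<bullet> ((G (\<psi> s) - \<psi> s) - (G (\<phi> s) - \<phi> s))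
            \<le> - (1/2) * ((\<psi> s - \<phi> s) \<bullet> (\<psi> s - \<phi> s))"
          by (rule diss)
      qed
      then show ?thesis using \<psi>(2) \<phi>0 by simp
    qed
    show ?thesis
    proof (intro exI[of _ \<phi>] conjI allI impI ballI)
      show "solves_ode (\<lambda>x. g (x, 0)) (ball 0 \<rho>) {0..} \<phi>"
        unfolding solves_ode_def using \<phi>' \<phi>_in G_eq by auto
    qed (use \<phi>0 unique decay in auto)
  qed
  then have stable: "\<exists>\<alpha>>0. \<exists>M>0. \<exists>\<delta>>0. \<forall>x0. norm x0 < \<delta> \<longrightarrow>
      (\<exists>\<phi>. solves_ode (\<lambda>x. g (x, 0)) (ball 0 \<rho>) {0..} \<phi> \<and> \<phi> 0 = x0 \<and>
        (\<forall>T>0. \<forall>\<psi>. solves_ode (\<lambda>x. g (x, 0)) (ball 0 \<rho>) {0..<T} \<psi> \<and> \<psi> 0 = x0 \<longrightarrow>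
           (\<forall>t\<in>{0..<T}. \<psi> t = \<phi> t)) \<and>
        (\<forall>t\<ge>0. norm (\<phi> t) \<le> M * norm x0 * exp (- \<alpha> * t)))"
    by (intro exI[of _ "1/2"] exI[of _ "1::real"] exI[of _ \<rho>] conjI \<rho>) auto
  show ?thesis
    unfolding exp_stabilizing_feedback_def using \<rho> D stable by auto
qed

text \<open>By \<open>fh\<close>, the map sending \<open>x\<close> to
  \<open>f (h (x, 0)) + x\<close> has derivative zero at the origin. Continuity of \<open>f'\<close>
  keeps its derivative small on a ball, and the mean value inequality turns this into the required
  Lipschitz bound.\<close>

lemma exp_stabilizing_zero_if_derivative:
  fixes f :: "'c::real_normed_vector \<Rightarrow> 'a::euclidean_space"
    and h :: "'a \<times> 'b::real_normed_vector \<Rightarrow> 'c"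
  assumes S: "open S" "0 \<in> S" and f0: "f 0 = 0"
    and f': "\<And>z. z \<in> S \<Longrightarrow> (f has_derivative blinfun_apply (f' z)) (at z)" "continuous_on S f'"
    and h: "bounded_linear h" and fh: "\<And>x. f' 0 (h (x, 0)) = - x"
    and N: "open N" "(0, 0) \<in> N"
  shows "\<exists>X. exp_stabilizing_feedback N (f \<circ> h) X (\<lambda>x. 0)"
proof -
  interpret h: bounded_linear h by (rule h)
  define L where "L x = h (x, 0)" for x
  have L: "bounded_linear L"
    unfolding L_def
    by (intro bounded_linear_compose[OF h] bounded_linear_Pair bounded_linear_ident bounded_linear_zero)
  interpret L: bounded_linear L by (rule L)
  obtain K where K: "0 < K" "\<And>x. norm (L x) \<le> norm x * K"
    using L.pos_bounded by blast
  have "isCont f' 0" using f'(2) S by (simp add: continuous_on_eq_continuous_at)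
  \<comment> \<open>The tolerance \<open>1 / (2 * K)\<close> offsets the bound \<open>K\<close> on
    \<open>L\<close>, leaving exactly 1/2 for the composed derivative.\<close>
  then obtain r where r: "0 < r" "\<And>z. dist z 0 < r \<Longrightarrow> dist (f' z) (f' 0) < 1 / (2 * K)"
    unfolding continuous_at_eps_delta using K(1)
    by (metis mult_pos_pos zero_less_divide_1_iff zero_less_numeral)
  have "open (L -` (S \<inter> ball 0 r) \<inter> (\<lambda>x. (x, 0)) -` N)"
    using S N by (intro open_Int open_vimage continuous_intros L.continuous_on) auto
  moreover have "0 \<in> L -` (S \<inter> ball 0 r) \<inter> (\<lambda>x. (x, 0)) -` N"
    using S N r(1) by (auto simp: L.zero)
  ultimately obtain \<rho> where \<rho>: "0 < \<rho>" and
    sub: "cball 0 \<rho> \<subseteq> L -` (S \<inter> ball 0 r) \<inter> (\<lambda>x. (x, 0)) -` N"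
    by (meson open_contains_cball)
  have "exp_stabilizing_feedback N (f \<circ> h) (ball 0 \<rho>) (\<lambda>x. 0)"
  proof (rule exp_stabilizing_feedback_zero[OF \<rho>])
    show "(f \<circ> h) (0, 0) = 0" using f0 L.zero by (simp add: L_def)
    show "(x, 0) \<in> N" if "x \<in> ball 0 \<rho>" for x
      using subsetD[OF sub, of x] that by auto
    fix x y :: 'a assume xy: "x \<in> cball 0 \<rho>" "y \<in> cball 0 \<rho>"
    have "norm ((f (L x) + x) - (f (L y) + y)) \<le> 1/2 * norm (x - y)"
    proof (rule differentiable_bound[OF convex_cball _ _ xy])
      fix x :: 'a assume x: "x \<in> cball 0 \<rho>"
      then have LxS: "L x \<in> S" and Lxr: "norm (L x) < r" using sub by auto
      show "((\<lambda>x. f (L x) + x) has_derivative (\<lambda>v. f' (L x) (L v) + v)) (at x within cball 0 \<rho>)"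
        by (rule has_derivative_add[OF
              has_derivative_compose[where g = f, OF bounded_linear_imp_has_derivative[OF L]]
              has_derivative_ident])
          (rule f'(1)[OF LxS])
      show "onorm (\<lambda>v. f' (L x) (L v) + v) \<le> 1/2"
      proof (rule onorm_le)
        fix v
        \<comment> \<open>The added \<open>v\<close> equals \<open>- f' 0 (L v)\<close>, so only the
          variation of \<open>f'\<close> remains.\<close>
        have "f' (L x) (L v) + v = (f' (L x) - f' 0) (L v)"
          using fh[of v] by (simp add: L_def blinfun.diff_left)
        also have "norm \<dots> \<le> norm (f' (L x) - f' 0) * norm (L v)"
          by (rule norm_blinfun)
        also have "\<dots> \<le> 1 / (2 * K) * (norm v * K)"
          using r(2)[of "L x"] Lxr K by (intro mult_mono) (auto simp: dist_norm)
        finally show "norm (f' (L x) (L v) + v) \<le> 1/2 * norm v"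
          using K(1) by simp
      qed
    qed
    then show "norm (((f \<circ> h) (x, 0) + x) - ((f \<circ> h) (y, 0) + y)) \<le> 1/2 * norm (x - y)"
      by (simp add: L_def)
  qed
  then show ?thesis by blast
qed


section \<open>Surjectivity of the derivative from linear openness\<close>

text \<open>If the range of \<open>A\<close> lies in the hyperplane normal to \<open>p\<close>, then
  in direction \<open>p\<close> the map \<open>g\<close> moves only by the linearization error.
  Openness demands a displacement \<open>\<kappa> * r\<close> in that direction, while the error is
  at most half of it for small \<open>r\<close>.\<close>

lemma linearly_open_imp_surj_derivative:
  fixes g :: "'a::real_normed_vector \<Rightarrow> 'b::euclidean_space"
  assumes g: "linearly_open_around D g z0 \<kappa>" and A: "(g has_derivative A) (at z0)"
  shows "surj A"
proof (rule ccontr)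
  assume "\<not> surj A"
  moreover have "linear A" using A by (rule has_derivative_linear)
  then have span: "span (range A) = range A"
    by (simp add: linear_subspace_image)
  ultimately obtain p where p: "p \<noteq> 0" "\<And>z. p \<bullet> A z = 0"
    using span_not_univ_subset_hyperplane[of "range A"] unfolding span by blast
  obtain W where \<kappa>: "0 < \<kappa>" and W: "open W" "z0 \<in> W"
    and cov: "\<forall>z\<in>W. \<forall>r>0. cball z r \<subseteq> W \<longrightarrow> cball (g z) (\<kappa> * r) \<subseteq> g ` cball z r"
    using g unfolding linearly_open_around_def by auto
  obtain e where e: "0 < e" "cball z0 e \<subseteq> W"
    using W by (meson open_contains_cball)
  obtain d where d: "0 < d"
    "\<And>z. norm (z - z0) < d \<Longrightarrow> norm (g z - g z0 - A (z - z0)) \<le> \<kappa> / 2 * norm (z - z0)"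
    using A \<kappa> unfolding has_derivative_at_alt by (meson half_gt_zero)
  \<comment> \<open>Halving \<open>d\<close> puts the whole closed ball of radius \<open>r\<close>
    inside the strict bound of the error estimate.\<close>
  define r where "r = min e (d / 2)"
  have r: "0 < r" "r \<le> e" "r < d" using e d by (auto simp: r_def)
  have "g z0 + (\<kappa> * r / norm p) *\<^sub>R p \<in> cball (g z0) (\<kappa> * r)"
    using p \<kappa> r by (simp add: dist_norm)
  moreover have "cball z0 r \<subseteq> W" using e(2) r(2) by (meson order_trans subset_cball)
  ultimately have "g z0 + (\<kappa> * r / norm p) *\<^sub>R p \<in> g ` cball z0 r"
    using cov[rule_format, OF W(2) r(1)] by blast
  then obtain z where z: "norm (z - z0) \<le> r" "g z = g z0 + (\<kappa> * r / norm p) *\<^sub>R p"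
    by (force simp: dist_norm norm_minus_commute)
  have "\<kappa> * r * norm p = p \<bullet> (g z - g z0 - A (z - z0))"
    using p by (simp add: z(2) inner_diff_right dot_square_norm power2_eq_square)
  also have "\<dots> \<le> norm p * norm (g z - g z0 - A (z - z0))"
    by (rule norm_cauchy_schwarz)
  also have "\<dots> \<le> norm p * (\<kappa> / 2 * r)"
  proof (rule mult_left_mono)
    have "norm (g z - g z0 - A (z - z0)) \<le> \<kappa> / 2 * norm (z - z0)"
      using z(1) r(3) by (intro d(2)) simp
    also have "\<dots> \<le> \<kappa> / 2 * r"
      using z(1) \<kappa> by (intro mult_left_mono) auto
    finally show "norm (g z - g z0 - A (z - z0)) \<le> \<kappa> / 2 * r" .
  qed simp
  finally show False
    using p(1) \<kappa> r(1) by (simp add: field_simps)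
qed

section \<open>Linear isomorphisms as changes of variables\<close>

lemma linear_inj_imp_stationary_linear_diffeo:
  fixes h :: "'a::euclidean_space \<Rightarrow> 'a"
  assumes h: "linear h" "inj h" and N: "open N"
  shows "stationary_linear_diffeo N h"
proof -
  obtain k where k: "linear k" "\<And>x. k (h x) = x" "\<And>x. h (k x) = x"
    using linear_injective_isomorphism[OF h] by auto
  have C1: "C1_on S L" if "linear L" for S and L :: "'a \<Rightarrow> 'a"
    unfolding C1_on_def using that
    by (intro exI[of _ "\<lambda>_. Blinfun L"])
      (auto simp: bounded_linear_Blinfun_apply linear_conv_bounded_linear
        intro: bounded_linear_imp_has_derivative)
  have "h ` N = k -` N" using k(2,3) by (auto intro: image_eqI[of _ h "k _"])
  then have open_image: "open (h ` N)"
    using N k(1) by (simp add: open_vimage linear_continuous_on linear_conv_bounded_linear)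
  have inj: "inj_on h N" using h(2) by (rule inj_on_subset) simp
  have inv: "inv_into N h z = k z" if "z \<in> h ` N" for z
    using that k(2) inv_into_f_f[OF inj] by auto
  obtain k' where k': "\<And>z. z \<in> h ` N \<Longrightarrow> (k has_derivative blinfun_apply (k' z)) (at z)"
    "continuous_on (h ` N) k'"
    using C1[OF k(1), of "h ` N"] unfolding C1_on_def by blast
  have "C1_on (h ` N) (inv_into N h)"
    unfolding C1_on_def
  proof (intro exI[of _ k'] conjI ballI k'(2))
    fix z assume z: "z \<in> h ` N"
    show "(inv_into N h has_derivative k' z) (at z)"
      by (rule has_derivative_transform_within_open[OF k'(1)[OF z] open_image z]) (simp add: inv)
  qed
  then show ?thesis
    unfolding stationary_linear_diffeo_def diffeo_onto_image_def
    using h N open_image inj C1[OF h(1)] linear_0[OF h(1)] by blast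
qed

text \<open>With a linear right inverse \<open>R\<close>, the space is the direct sum of the kernel
  of \<open>A\<close> and the range of \<open>R\<close>, so the kernel has the dimension of the
  control space. For an isometry \<open>P\<close> onto the kernel,
  \<open>h (x, u) = P u - R x\<close>: applying \<open>A\<close> recovers \<open>x\<close> up to
  sign, and injectivity of \<open>P\<close> recovers \<open>u\<close>.\<close>

lemma surj_linear_stabilizing_isomorphism:
  fixes A :: "'a::euclidean_space \<times> 'b::euclidean_space \<Rightarrow> 'a"
  assumes A: "linear A" "surj A"
  obtains h :: "'a \<times> 'b \<Rightarrow> 'a \<times> 'b" where "linear h" "inj h" "\<And>x. A (h (x, 0)) = - x"
proof -
  obtain R where R: "linear R" "\<And>x. A (R x) = x"
    using linear_surjective_right_inverse[OF A] by (auto simp: fun_eq_iff)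
  define K where "K = {z. A z = 0}"
  have K: "subspace K" unfolding K_def using A(1) by (rule linear_subspace_kernel)
  have "inj R" using R(2) by (metis injI)
  have sub: "subspace (range R)" using R(1) by (rule linear_subspace_image) simp
  have "z \<in> {x + y |x y. x \<in> K \<and> y \<in> range R}" for z
  proof -
    have "z = (z - R (A z)) + R (A z)" by simp
    moreover have "z - R (A z) \<in> K" by (simp add: K_def linear_diff[OF A(1)] R(2))
    ultimately show ?thesis by blast
  qed
  then have "{x + y |x y. x \<in> K \<and> y \<in> range R} = UNIV" by blast
  moreover have "K \<inter> range R = {0}"
    using R(2) linear_0[OF A(1)] linear_0[OF R(1)] by (auto simp: K_def)
  moreover have "dim (range R) = DIM('a)"
    using dim_image_eq[OF R(1), of UNIV] \<open>inj R\<close> by simp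
  ultimately have "dim K = dim (UNIV :: 'b set)"
    using dim_sums_Int[OF K sub] by simp
  then obtain P :: "'b \<Rightarrow> 'a \<times> 'b" where P: "linear P" "P ` UNIV = K" "\<And>u. norm (P u) = norm u"
    using isometry_subspaces[OF subspace_UNIV K] by (metis UNIV_I)
  define h where "h z = P (snd z) - R (fst z)" for z
  have AP: "A (P u) = 0" for u using P(2) by (auto simp: K_def)
  show thesis
  proof
    show h: "linear h"
      unfolding h_def
      by (intro linear_compose_sub linear_compose[OF linear_snd P(1), unfolded o_def]
          linear_compose[OF linear_fst R(1), unfolded o_def])
    have Ah: "A (h z) = - fst z" for z
      by (simp add: h_def linear_diff[OF A(1)] AP R(2))
    then show "A (h (x, 0)) = - x" for x by simp
    show "inj h"
      unfolding linear_injective_0[OF h]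
    proof (intro allI impI)
      fix z assume z: "h z = 0"
      then have "fst z = 0" using Ah[of z] linear_0[OF A(1)] by simp
      with z have "P (snd z) = 0" by (simp add: h_def linear_0[OF R(1)])
      then have "snd z = 0" using P(3)[of "snd z"] by simp
      with \<open>fst z = 0\<close> show "z = 0" by (simp add: prod_eq_iff)
    qed
  qed
qed

section \<open>Jacobian matrix and its right pseudoinverse\<close>

lemma linear_unstack: "linear unstack"
  by (rule linearI) (simp_all add: unstack_def vec_eq_iff)

lemma linear_stack: "linear stack"
  by (rule linearI) (simp_all add: stack_def vec_eq_iff split: sum.split)

lemma unstack_stack [simp]: "unstack (stack z) = z"
  by (simp add: unstack_def stack_def prod_eq_iff vec_eq_iff)

lemma stack_unstack [simp]: "stack (unstack v) = v"
  by (simp add: unstack_def stack_def vec_eq_iff split: sum.split)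

lemma stack_zero [simp]: "stack (0, 0) = 0"
  by (simp add: stack_def vec_eq_iff split: sum.split)

text \<open>Chain rule through \<open>unstack\<close>; this is the bridge between the derivative on
  pairs and the matrix on stacked vectors.\<close>

lemma full_jacobian_mult:
  assumes "(f has_derivative f') (at z)"
  shows "full_jacobian f z *v v = f' (unstack v)"
proof -
  have "(f \<circ> unstack has_derivative f' \<circ> unstack) (at (stack z))"
    using assms
    by (intro diff_chain_at linear_imp_has_derivative linear_unstack) simp
  then have "frechet_derivative (f \<circ> unstack) (at (stack z)) = f' \<circ> unstack"
    and "linear (f' \<circ> unstack)"
    by (simp_all only: frechet_derivative_at[symmetric] has_derivative_linear)
  then show ?thesis
    by (simp add: full_jacobian_def jacobian_def matrix_works)
qed

text \<open>For \<open>x\<close> in the kernel of the Gram matrix, pairing with \<open>x\<close>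
  shows that \<open>transpose J *v x\<close> has norm zero. Writing \<open>x = J *v v\<close> and
  moving \<open>J\<close> across the inner product then gives
  \<open>x \<bullet> x = 0\<close>.\<close>

lemma surj_imp_invertible_mult_transpose:
  fixes J :: "real^'k^'n"
  assumes "surj ((*v) J)"
  shows "invertible (J ** transpose J)"
  unfolding invertible_left_inverse matrix_left_invertible_ker
proof (intro allI impI)
  fix x assume "(J ** transpose J) *v x = 0"
  then have "x \<bullet> (J *v (transpose J *v x)) = 0"
    by (simp only: matrix_vector_mul_assoc inner_zero_right)
  then have *: "transpose J *v x = 0"
    by (simp flip: dot_lmul_matrix)
  obtain v where "x = J *v v" using assms by (metis surjD)
  then have "x \<bullet> x = (transpose J *v x) \<bullet> v"
    by (simp add: dot_lmul_matrix)
  with * show "x = 0" by simp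
qed

lemma matrix_inv_right_inverse:
  assumes "invertible A"
  shows "A ** matrix_inv A = mat 1"
  using assms unfolding invertible_def matrix_inv_def by (rule someI2_ex) simp

lemma right_pinv_right_inverse:
  assumes "invertible (J ** transpose J)"
  shows "J *v (right_pinv J *v x) = x"
  by (simp add: right_pinv_def matrix_vector_mul_assoc matrix_mul_assoc matrix_inv_right_inverse[OF assms])

lemma linear_pinv_change: "linear (pinv_change J)"
proof -
  have "pinv_change J = (\<lambda>z. unstack (- (right_pinv J *v fst z) + stack (0, snd z)))"
    by (auto simp: pinv_change_def fun_eq_iff)
  moreover have "linear \<dots>"
    by (rule linearI)
      (simp_all add: unstack_def stack_def vec_eq_iff algebra_simps matrix_vector_mult_scaleR
        split: sum.split)
  ultimately show ?thesis by simp
qed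

lemma mult_stack_pinv_change:
  assumes "invertible (J ** transpose J)"
  shows "J *v stack (pinv_change J (x, 0)) = - x"
  using right_pinv_right_inverse[OF assms, of x]
  by (simp add: pinv_change_def linear_neg[OF matrix_vector_mul_linear])

text \<open>A kernel element \<open>(x, u)\<close> satisfies
  \<open>right_pinv J *v x = stack (0, u)\<close>. With \<open>y\<close> the inverse Gram matrix
  applied to \<open>x\<close>, the state components of \<open>transpose J *v y\<close> vanish; they
  form \<open>transpose (state_block J) *v y\<close>, so \<open>y = 0\<close>, and both
  \<open>x\<close> and \<open>u\<close> vanish.\<close>

lemma inj_pinv_change:
  fixes J :: "real^('n::finite + 'm::finite)^'n"
  assumes J: "invertible (J ** transpose J)" and S: "invertible (state_block J)"
  shows "inj (pinv_change J)"
  unfolding linear_injective_0[OF linear_pinv_change]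
proof (intro allI impI)
  fix z :: "(real^'n) \<times> (real^'m)"
  assume "pinv_change J z = 0"
  then have "stack (pinv_change J z) = 0"
    by (simp add: linear_0[OF linear_stack])
  then have R: "right_pinv J *v fst z = stack (0, snd z)"
    by (cases z) (simp add: pinv_change_def)
  define y where "y = matrix_inv (J ** transpose J) *v fst z"
  have y: "transpose J *v y = stack (0, snd z)"
    using R by (simp add: y_def right_pinv_def matrix_vector_mul_assoc)
  have "(transpose (state_block J) *v y) $ i = (transpose J *v y) $ Inl i" for i
    by (simp add: matrix_vector_mult_def transpose_def state_block_def)
  then have "transpose (state_block J) *v y = 0"
    unfolding vec_eq_iff y by (simp add: stack_def)
  then have "y = 0"
    using transpose_invertible[OF S]
    by (metis invertible_left_inverse matrix_left_invertible_ker)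
  with y R have "right_pinv J *v fst z = 0" by simp
  then have "fst z = 0"
    using right_pinv_right_inverse[OF J, of "fst z"] by simp
  moreover have "snd z = 0"
  proof -
    have "(0, snd z) = unstack (transpose J *v y)"
      unfolding y by simp
    also have "\<dots> = 0"
      by (simp add: \<open>y = 0\<close> linear_0[OF linear_unstack])
    finally show ?thesis by (simp add: prod_eq_iff)
  qed
  ultimately show "z = 0" by (simp add: prod_eq_iff)
qed

section \<open>Stabilization by the isomorphism and by the pseudoinverse\<close>

theorem theorem17:
  fixes U :: "(real^'n::finite) set" and V :: "(real^'m::finite) set"
    and f :: "(real^'n) \<times> (real^'m) \<Rightarrow> real^'n"
  assumes "open (U \<times> V)" and "(0, 0) \<in> U \<times> V"
    and "C1_on (U \<times> V) f" and "f (0, 0) = 0"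
    and "cov (U \<times> V) f (0, 0) > 0"
  shows "(\<exists>N h. open N \<and> (0, 0) \<in> N \<and> N \<subseteq> U \<times> V \<and>
            stationary_linear_diffeo N h \<and> h ` N \<subseteq> U \<times> V \<and>
            locally_exp_stabilizable N (f \<circ> h)) \<and>
         (let J = full_jacobian f (0, 0); h = pinv_change J in
            invertible (J ** transpose J) \<and>
            (\<exists>N. open N \<and> (0, 0) \<in> N \<and> N \<subseteq> U \<times> V \<and>
               linear h \<and> h (0, 0) = (0, 0) \<and> h ` N \<subseteq> U \<times> V \<and>
               (invertible (state_block J) \<longrightarrow> stationary_linear_diffeo N h) \<and>
               locally_exp_stabilizable N (f \<circ> h) \<and>
               (\<exists>X. exp_stabilizing_feedback N (f \<circ> h) X (\<lambda>x. 0))))"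
proof -
  define W where "W = U \<times> V"
  have W: "open W" "0 \<in> W" and f0: "f 0 = 0"
    using assms(1,2,4) by (simp_all only: W_def zero_prod_def)
  obtain f' where f': "\<And>z. z \<in> W \<Longrightarrow> (f has_derivative blinfun_apply (f' z)) (at z)"
    "continuous_on W f'"
    using assms(3) unfolding C1_on_def W_def by blast
  define J where "J = full_jacobian f (0, 0)"
  \<comment> \<open>Positivity of \<open>cov\<close> rules out its default value 0, so some modulus
    exists.\<close>
  have "\<exists>\<kappa>. linearly_open_around (U \<times> V) f (0, 0) \<kappa>"
  proof (rule ccontr)
    assume "\<not> ?thesis"
    then have "cov (U \<times> V) f (0, 0) = 0" by (simp only: cov_def if_False)
    with assms(5) show False by (simp only: less_irrefl)
  qed
  then obtain \<kappa> where "linearly_open_around W f 0 \<kappa>"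
    unfolding W_def zero_prod_def by blast
  then have surj: "surj (f' 0)"
    using f'(1)[OF W(2)] by (rule linearly_open_imp_surj_derivative)
  have J_mult: "J *v v = f' 0 (unstack v)" for v
    using full_jacobian_mult[OF f'(1)[OF W(2)]] by (simp only: J_def zero_prod_def)
  have "surj ((*v) J)"
  proof (rule surjI)
    show "J *v stack (inv (f' 0) y) = y" for y
      unfolding J_mult unstack_stack using surj by (rule surj_f_inv_f)
  qed
  then have inv: "invertible (J ** transpose J)"
    by (rule surj_imp_invertible_mult_transpose)
  have main: "\<exists>N. open N \<and> (0, 0) \<in> N \<and> N \<subseteq> W \<and> h ` N \<subseteq> W \<and>
      locally_exp_stabilizable N (f \<circ> h) \<and> (\<exists>X. exp_stabilizing_feedback N (f \<circ> h) X (\<lambda>x. 0))"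
    if h: "linear h" and fh: "\<And>x. f' 0 (h (x, 0)) = - x" for h
  proof -
    have bl: "bounded_linear h" using h by (simp add: linear_conv_bounded_linear)
    have h0: "h (0, 0) = 0" using linear_0[OF h] by (simp add: zero_prod_def)
    have N: "open (W \<inter> h -` W)" "(0, 0) \<in> W \<inter> h -` W"
      using W bl h0 by (auto simp: zero_prod_def intro!: open_Int open_vimage linear_continuous_on)
    have "\<exists>X. exp_stabilizing_feedback (W \<inter> h -` W) (f \<circ> h) X (\<lambda>x. 0)"
      by (rule exp_stabilizing_zero_if_derivative[OF W f0 f' bl fh N])
    moreover from this have "locally_exp_stabilizable (W \<inter> h -` W) (f \<circ> h)"
      unfolding locally_exp_stabilizable_def using h0 f0 by auto
    ultimately show ?thesis
      using N by (intro exI[of _ "W \<inter> h -` W"]) blast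
  qed
  obtain h :: "(real^'n) \<times> (real^'m) \<Rightarrow> (real^'n) \<times> (real^'m)"
    where h: "linear h" "inj h" "\<And>x. f' 0 (h (x, 0)) = - x"
    using surj_linear_stabilizing_isomorphism[OF bounded_linear.linear[OF blinfun.bounded_linear_right] surj]
    by blast
  have "f' 0 (pinv_change J (x, 0)) = - x" for x
    using mult_stack_pinv_change[OF inv, of x] by (simp add: J_mult)
  note pinv = main[OF linear_pinv_change this]
  have part1: "\<exists>N h. open N \<and> (0, 0) \<in> N \<and> N \<subseteq> W \<and> stationary_linear_diffeo N h \<and>
      h ` N \<subseteq> W \<and> locally_exp_stabilizable N (f \<circ> h)"
    using main[OF h(1,3)] linear_inj_imp_stationary_linear_diffeo[OF h(1,2)] by blast
  have "pinv_change J (0, 0) = (0, 0)"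
    using linear_0[OF linear_pinv_change[of J]] by (simp add: zero_prod_def)
  moreover have "stationary_linear_diffeo N (pinv_change J)"
    if "invertible (state_block J)" "open N" for N
    using linear_pinv_change inj_pinv_change[OF inv that(1)] that(2)
    by (rule linear_inj_imp_stationary_linear_diffeo)
  ultimately show ?thesis
    using part1 pinv inv linear_pinv_change[of J]
    unfolding Let_def J_def[symmetric] W_def[symmetric] by blast
qed

end
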